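(* Let $n\ge 2$ be an integer, $P_n$ the polycyclic monoid and $\beta\colon P_n\curvearrowright\Sigma_n^{\mathbb{N}}$ its canonical action. Assume that $T\subsetneq P_n$ is a $\beta$-join closed subsemigroup which contains $M_n$. Then $T=P_n^m$ holds for some $m\in\mathbb{N}=\{0,1,2,\dots\}$.
   Context: The polycyclic monoid $P_n$ is the inverse monoid with zero generated by $s_1,\dots,s_n$ subject to $s_i^*s_j=\delta_{i,j}1$ (i.e. $s_i^*s_i=1$ and $s_i^*s_j=0$ for $i\ne j$). Let $\Sigma_n=\{1,\dots,n\}$, let $\Sigma_n^*$ be the set of finite words on $\Sigma_n$ (including the empty word $\varepsilon$), with $|\mu|$ the length of $\mu$, and $s_{\mu}:=s_{\mu_1}\cdots s_{\mu_{|\mu|}}$, $s_{\varepsilon}=1$. Every element of $P_n\setminus\{0\}$ is uniquely of the form $s_{\mu}s_{\nu}^*$ with $\mu,\nu\in\Sigma_n^*$. Idempotents are $0$ and the $s_\mu s_\mu^*$; $E(P_n)$ is the set of idempotents. $\Sigma_n^{\mathbb{N}}$ is the compact space of infinite sequences in $\Sigma_n$ (product topology) and $C(\mu)$ is the set of infinite sequences beginning with $\mu$. The action $\beta$ is given by the homeomorphisms $\beta_{s_{\mu}s_{\nu}^*}\colon C(\nu)\to C(\mu)$, $\beta_{s_\mu s_\nu^*}(\nu x)=\mu x$ for $x\in\Sigma_n^{\mathbb{N}}$, and $\beta_0$ is the empty map. For $e\in E(P_n)$, $D_e:=\operatorname{dom}(\beta_e)$, so $D_{s_\mu s_\mu^*}=C(\mu)$,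 $D_0=\emptyset$. A subsemigroup is a subset closed under products and the involution $s\mapsto s^*$. A subsemigroup $T\subset P_n$ containing $E(P_n)$ is $\beta$-join closed if for every $s\in P_n$: $s\in T$ iff there is a finite $F\subset E(P_n)$ with $sf\in T$ for all $f\in F$ and $D_{s^*s}\subset\bigcup_{f\in F}D_f$. For $k,l\in\mathbb{N}$, $P_n^{k,l}:=\{s_{\mu}s_{\nu}^*\mid |\mu|=k,|\nu|=l\}$. $M_n:=\bigcup_{k\in\mathbb{N}}P_n^{k,k}\cup\{0\}$. For $m\in\mathbb{N}$, $P_n^m:=\bigcup_{k-l\in m\mathbb{Z}}P_n^{k,l}\cup\{0\}$ (so $P_n^0=M_n$). *)

theory Defs
  imports "HOL-Library.Stream" "HOL-Library.Sublist"
begin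

text \<open>
  Nonzero elements are represented by their normal forms: \<open>Nf \<mu> \<nu>\<close> stands for
  \<open>s\<^sub>\<mu> s\<^sub>\<nu>\<^sup>*\<close>.  The type carries the polycyclic monoid on countably many generators
  \<open>gen i\<close> (\<open>i :: nat\<close>); the polycyclic monoid on \<open>n\<close> generators is the submonoid \<open>polycyc n\<close> of
  elements all of whose letters are in \<open>{1..n}\<close>.  The facts \<open>polycyc_inverse_monoid\<close>,
  \<open>star_gen_mult_gen\<close>, \<open>polycyc_generated\<close> and \<open>polycyc_universal\<close> below show that this is the
  inverse monoid with zero presented by \<open>s\<^sub>i\<^sup>* s\<^sub>j = \<delta>\<^sub>i\<^sub>j 1\<close> for \<open>i, j \<in> {1..n}\<close>.
\<close>

datatype polycyclic = Zero | Nf "nat list" "nat list"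

instantiation polycyclic :: "{one, zero, times}"
begin

definition zero_polycyclic :: polycyclic where "0 = Zero"

definition one_polycyclic :: polycyclic where "1 = Nf [] []"

fun times_polycyclic :: "polycyclic \<Rightarrow> polycyclic \<Rightarrow> polycyclic" where
  "Nf \<mu> \<nu> * Nf \<alpha> \<beta> =
     (if prefix \<nu> \<alpha> then Nf (\<mu> @ drop (length \<nu>) \<alpha>) \<beta>
      else if prefix \<alpha> \<nu> then Nf \<mu> (\<beta> @ drop (length \<alpha>) \<nu>)
      else Zero)"
| "Zero * y = Zero"
| "Nf \<mu> \<nu> * Zero = Zero"

instance ..

end

fun star :: "polycyclic \<Rightarrow> polycyclic" where
  "star Zero = Zero"
| "star (Nf \<mu> \<nu>) = Nf \<nu> \<mu>"

lemma Nf_neq_0 [simp]: "Nf \<mu> \<nu> \<noteq> 0" "0 \<noteq> Nf \<mu> \<nu>"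
  by (simp_all add: zero_polycyclic_def)

lemma Nf_mult_append_right [simp]: "Nf \<mu> \<nu> * Nf (\<nu> @ \<gamma>) \<beta> = Nf (\<mu> @ \<gamma>) \<beta>"
  by simp

lemma Nf_mult_append_left [simp]: "Nf \<mu> (\<alpha> @ \<gamma>) * Nf \<alpha> \<beta> = Nf \<mu> (\<beta> @ \<gamma>)"
  by (auto simp: prefix_def)

lemma Nf_mult_same [simp]: "Nf \<mu> \<nu> * Nf \<nu> \<beta> = Nf \<mu> \<beta>"
  by simp

lemma Nf_mult_parallel [simp]: "\<nu> \<parallel> \<alpha> \<Longrightarrow> Nf \<mu> \<nu> * Nf \<alpha> \<beta> = 0"
  by (auto simp: zero_polycyclic_def parallel_def)

declare times_polycyclic.simps(1) [simp del]

lemma prefix_comparison: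
  fixes b c :: "'a list"
  obtains u where "b = c @ u" | u where "c = b @ u" | "b \<parallel> c"
  by (meson parallelI prefixE)

instance polycyclic :: "{monoid_mult, mult_zero}"
proof
  show zl: "0 * x = 0" and zr: "x * 0 = 0" for x :: polycyclic
    by (cases x; simp add: zero_polycyclic_def)+
  show "1 * x = x" "x * 1 = x" for x :: polycyclic
    by (cases x; simp add: one_polycyclic_def times_polycyclic.simps prefix_def)+
  show "x * y * z = x * (y * z)" for x y z :: polycyclic
  proof (cases "x = 0 \<or> y = 0 \<or> z = 0")
    case True
    then show ?thesis
      by (auto simp: zl zr)
  next
    case False
    then obtain a b c d e f where [simp]: "x = Nf a b" "y = Nf c d" "z = Nf e f"
      by (metis polycyclic.exhaust zero_polycyclic_def)
    have par: "b @ u \<parallel> c" "b \<parallel> c @ u" if "b \<parallel> c" for b c u :: "nat list"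
      using parallel_append[OF that, of u "[]"] parallel_append[OF that, of "[]" u] by simp_all
    show ?thesis
    proof (cases b c rule: prefix_comparison[case_names 1 2 3])
      case bc: (1 u)
      show ?thesis
      proof (cases d e rule: prefix_comparison[case_names 1 2 3])
        case (1 v)
        with bc show ?thesis by simp
      next
        case (2 v)
        with bc show ?thesis by (simp add: times_polycyclic.simps)
      next
        case 3
        with bc show ?thesis by (simp add: zr par)
      qed
    next
      case (2 u)
      then show ?thesis
        by (cases d e rule: prefix_comparison) (simp_all add: zr)
    next
      case 3
      then show ?thesis
        by (cases d e rule: prefix_comparison) (simp_all add: zl zr par)
    qed
  qed
qed

lemma Nf_idempotent: "Nf \<mu> \<nu> * Nf \<mu> \<nu> = Nf \<mu> \<nu> \<Longrightarrow> \<mu> = \<nu>"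
  by (cases \<nu> \<mu> rule: prefix_comparison) auto

lemma star_0 [simp]: "star 0 = 0"
  by (simp add: zero_polycyclic_def)

lemma star_1 [simp]: "star 1 = 1"
  by (simp add: one_polycyclic_def)

lemma star_star [simp]: "star (star x) = x"
  by (cases x) auto

lemma star_mult: "star (x * y) = star y * star x"
proof (cases "x = 0 \<or> y = 0")
  case True
  then show ?thesis by auto
next
  case False
  then obtain a b c d where "x = Nf a b" "y = Nf c d"
    by (metis polycyclic.exhaust zero_polycyclic_def)
  then show ?thesis
    by (cases b c rule: prefix_comparison) (auto simp: parallel_commute)
qed


definition gen :: "nat \<Rightarrow> polycyclic" where
  "gen i = Nf [i] []"

definition gen_word :: "nat list \<Rightarrow> polycyclic" where
  "gen_word \<mu> = prod_list (map gen \<mu>)"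

definition polycyc :: "nat \<Rightarrow> polycyclic set" where
  "polycyc n = {0} \<union> {Nf \<mu> \<nu> | \<mu> \<nu>. \<mu> \<in> lists {1..n} \<and> \<nu> \<in> lists {1..n}}"

lemma gen_word_eq: "gen_word \<mu> = Nf \<mu> []"
proof (induction \<mu>)
  case Nil
  then show ?case by (simp add: gen_word_def one_polycyclic_def)
next
  case (Cons i \<mu>)
  then have "gen_word (i # \<mu>) = Nf [i] [] * Nf \<mu> []"
    by (simp add: gen_word_def gen_def)
  then show ?case
    using Nf_mult_append_right[of "[i]" "[]" \<mu> "[]"] by simp
qed

lemma gen_word_mult_star_gen_word: "gen_word \<mu> * star (gen_word \<nu>) = Nf \<mu> \<nu>"
  by (simp add: gen_word_eq)

lemma star_gen_mult_gen: "star (gen i) * gen j = (if i = j then 1 else 0)"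
  by (simp add: gen_def one_polycyclic_def zero_polycyclic_def times_polycyclic.simps)

lemma polycyc_closed:
  "0 \<in> polycyc n" "1 \<in> polycyc n"
  "i \<in> {1..n} \<Longrightarrow> gen i \<in> polycyc n"
  "x \<in> polycyc n \<Longrightarrow> star x \<in> polycyc n"
  "x \<in> polycyc n \<Longrightarrow> y \<in> polycyc n \<Longrightarrow> x * y \<in> polycyc n"
proof -
  show "x * y \<in> polycyc n" if "x \<in> polycyc n" "y \<in> polycyc n"
  proof (cases "x = 0 \<or> y = 0")
    case True
    then show ?thesis by (auto simp: polycyc_def)
  next
    case False
    with that obtain a b c d where "x = Nf a b" "y = Nf c d"
      "a \<in> lists {1..n}" "b \<in> lists {1..n}" "c \<in> lists {1..n}" "d \<in> lists {1..n}"
      by (auto simp: polycyc_def)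
    then show ?thesis
      by (cases b c rule: prefix_comparison) (auto simp: polycyc_def)
  qed
qed (auto simp: polycyc_def one_polycyclic_def gen_def)

lemma polycyc_inverse_monoid:
  assumes "x \<in> polycyc n"
  shows "\<exists>!y. y \<in> polycyc n \<and> x * y * x = x \<and> y * x * y = y"
    and "x * star x * x = x"
    and "star x * x * star x = star x"
proof -
  show *: "x * star x * x = x" "star x * x * star x = star x"
    by (cases x; simp flip: zero_polycyclic_def)+
  have uniq: "y = star x" if "x * y * x = x" "y * x * y = y" for y
  proof (cases "x = 0 \<or> y = 0")
    case True
    with that show ?thesis by auto
  next
    case False
    then obtain a b c d where xy: "x = Nf a b" "y = Nf c d"
      by (metis polycyclic.exhaust zero_polycyclic_def)
    have idem: "x * y * (x * y) = x * y" "y * x * (y * x) = y * x"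
      using that by (simp_all flip: mult.assoc)
    show ?thesis
    proof (cases b c rule: prefix_comparison[case_names 1 2 3])
      case (1 u)
      with xy idem(1) have "a = d @ u" by (intro Nf_idempotent) simp
      with 1 xy that(2) show ?thesis by simp
    next
      case (2 u)
      with xy idem(1) have "a @ u = d" by (intro Nf_idempotent) simp
      then have "d = a @ u" by (rule sym)
      with 2 xy that(1) show ?thesis by simp
    next
      case 3
      with xy that(1) show ?thesis by simp
    qed
  qed
  show "\<exists>!y. y \<in> polycyc n \<and> x * y * x = x \<and> y * x * y = y"
  proof (rule ex1I)
    show "star x \<in> polycyc n \<and> x * star x * x = x \<and> star x * x * star x = star x"
      using * polycyc_closed(4)[OF assms] by simp
  qed (elim conjE, rule uniq)
qed

lemma polycyc_generated:
  assumes "0 \<in> A" "1 \<in> A" "\<And>i. i \<in> {1..n} \<Longrightarrow> gen i \<in> A"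
    and "\<And>x. x \<in> A \<Longrightarrow> star x \<in> A" "\<And>x y. x \<in> A \<Longrightarrow> y \<in> A \<Longrightarrow> x * y \<in> A"
  shows "polycyc n \<subseteq> A"
proof -
  have *: "gen_word \<mu> \<in> A" if "\<mu> \<in> lists {1..n}" for \<mu>
    using that
  proof (induction rule: lists.induct)
    case Nil
    then show ?case by (simp add: gen_word_def assms)
  next
    case (Cons i \<mu>)
    then show ?case using assms(3)[of i] assms(5) by (simp add: gen_word_def)
  qed
  have "Nf \<mu> \<nu> \<in> A" if "\<mu> \<in> lists {1..n}" "\<nu> \<in> lists {1..n}" for \<mu> \<nu>
    using assms(5)[OF *[OF that(1)] assms(4)[OF *[OF that(2)]]]
    by (simp add: gen_word_mult_star_gen_word)
  with assms(1) show ?thesis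
    unfolding polycyc_def by blast
qed

text \<open>
  The universal property holds even with respect to arbitrary monoids with zero and involution,
  not only with respect to inverse monoids with zero.  Uniqueness of \<open>h\<close> on \<open>polycyc n\<close> is
  \<open>polycyc_generated\<close>.
\<close>

lemma polycyc_universal:
  fixes inv :: "'b :: {monoid_mult, mult_zero} \<Rightarrow> 'b" and t :: "nat \<Rightarrow> 'b"
  assumes inv_inv: "\<And>x. inv (inv x) = x"
    and inv_mult: "\<And>x y. inv (x * y) = inv y * inv x"
    and rel: "\<And>i j. i \<in> {1..n} \<Longrightarrow> j \<in> {1..n} \<Longrightarrow> inv (t i) * t j = (if i = j then 1 else 0)"
  obtains h where "h 0 = 0" "h 1 = 1" "\<And>i. i \<in> {1..n} \<Longrightarrow> h (gen i) = t i"
    "\<And>x. x \<in> polycyc n \<Longrightarrow> h (star x) = inv (h x)"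
    "\<And>x y. x \<in> polycyc n \<Longrightarrow> y \<in> polycyc n \<Longrightarrow> h (x * y) = h x * h y"
proof -
  define w where "w \<mu> = prod_list (map t \<mu>)" for \<mu>
  define h where "h x = (case x of Zero \<Rightarrow> 0 | Nf \<mu> \<nu> \<Rightarrow> w \<mu> * inv (w \<nu>))" for x
  have inv_0: "inv 0 = 0"
    using inv_mult[of 0 "inv 0"] by (simp add: inv_inv)
  have inv_1: "inv 1 = 1"
    using inv_mult[of 1 "inv 1"] by (simp add: inv_inv)
  have w_append: "w (\<mu> @ \<nu>) = w \<mu> * w \<nu>" for \<mu> \<nu>
    by (simp add: w_def)
  have w_simps [simp]: "w [] = 1" "w (i # \<mu>) = t i * w \<mu>" for i \<mu>
    by (simp_all add: w_def)
  have h_simps [simp]: "h 0 = 0" "h (Nf \<mu> \<nu>) = w \<mu> * inv (w \<nu>)" for \<mu> \<nu>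
    by (simp_all add: h_def zero_polycyclic_def)
  have canc_Cons: "inv (t i) * (t j * x) = (if i = j then x else 0)"
    if "i \<in> {1..n}" "j \<in> {1..n}" for i j x
    using rel[OF that] by (simp flip: mult.assoc)
  have canc: "inv (w \<nu>) * (w \<nu> * x) = x" if "\<nu> \<in> lists {1..n}" for \<nu> x
    using that by (induction \<nu> arbitrary: x) (simp_all add: inv_1 inv_mult mult.assoc canc_Cons)
  have canc': "inv (w \<nu>) * w \<nu> = 1" if "\<nu> \<in> lists {1..n}" for \<nu>
    using canc[OF that, of 1] by simp
  have zero: "inv (w \<nu>) * (w \<alpha> * x) = 0"
    if par: "\<nu> \<parallel> \<alpha>" and "\<nu> \<in> lists {1..n}" "\<alpha> \<in> lists {1..n}" for \<nu> \<alpha> x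
  proof -
    obtain \<gamma> i \<nu>' j \<alpha>' where "i \<noteq> j" "\<nu> = \<gamma> @ i # \<nu>'" "\<alpha> = \<gamma> @ j # \<alpha>'"
      using parallel_decomp[OF par] by blast
    with that show ?thesis
      by (simp add: w_append inv_mult mult.assoc canc canc_Cons)
  qed
  show ?thesis
  proof (rule that[of h])
    show "h 0 = 0" "h 1 = 1"
      by (simp_all add: one_polycyclic_def inv_1)
    show "h (gen i) = t i" for i
      by (simp add: gen_def inv_1)
    show "h (star x) = inv (h x)" for x
      by (cases x) (simp_all add: inv_0 inv_mult inv_inv flip: zero_polycyclic_def)
    show "h (x * y) = h x * h y" if "x \<in> polycyc n" "y \<in> polycyc n" for x y
    proof (cases "x = 0 \<or> y = 0")
      case True
      then show ?thesis by auto
    next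
      case False
      with that obtain a b c d where "x = Nf a b" "y = Nf c d"
        "b \<in> lists {1..n}" "c \<in> lists {1..n}"
        by (auto simp: polycyc_def)
      then show ?thesis
        by (cases b c rule: prefix_comparison)
           (auto simp: w_append inv_mult mult.assoc canc canc' zero)
    qed
  qed
qed


definition cylinder :: "nat \<Rightarrow> nat list \<Rightarrow> nat stream set" where
  "cylinder n \<mu> = {y \<in> streams {1..n}. \<exists>x. y = \<mu> @- x}"

fun beta :: "nat \<Rightarrow> polycyclic \<Rightarrow> nat stream \<rightharpoonup> nat stream" where
  "beta n Zero = Map.empty"
| "beta n (Nf \<mu> \<nu>) =
     (\<lambda>y. if y \<in> cylinder n \<nu> then Some (\<mu> @- sdrop (length \<nu>) y) else None)"

definition Dom :: "nat \<Rightarrow> polycyclic \<Rightarrow> nat stream set" where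
  "Dom n e = dom (beta n e)"

lemma beta_0: "beta n 0 = Map.empty"
  by (simp add: zero_polycyclic_def)

lemma beta_Nf_shift:
  assumes "\<nu> \<in> lists {1..n}" "x \<in> streams {1..n}"
  shows "beta n (Nf \<mu> \<nu>) (\<nu> @- x) = Some (\<mu> @- x)"
  using assms by (auto simp: cylinder_def shift_streams sdrop_shift)

lemma beta_mult:
  assumes "x \<in> polycyc n" "y \<in> polycyc n"
  shows "beta n (x * y) = beta n x \<circ>\<^sub>m beta n y"
proof (cases "x = 0 \<or> y = 0")
  case True
  then show ?thesis
    by (auto simp: zero_polycyclic_def[symmetric] map_comp_def beta_0 split: option.split)
next
  case False
  with assms obtain a b c d where xy: "x = Nf a b" "y = Nf c d"
    and l: "a \<in> lists {1..n}" "b \<in> lists {1..n}" "c \<in> lists {1..n}" "d \<in> lists {1..n}"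
    by (auto simp: polycyc_def)
  show ?thesis
  proof
    fix z
    show "beta n (x * y) z = (beta n x \<circ>\<^sub>m beta n y) z"
    proof (cases "z \<in> cylinder n d")
      case True
      then obtain w where z: "z = d @- w" and w: "w \<in> streams {1..n}"
        by (auto simp: cylinder_def streams_iff_sset)
      have cw: "c @- w \<in> streams {1..n}"
        using l w by (simp add: shift_streams)
      have y: "beta n y z = Some (c @- w)"
        using xy l z w beta_Nf_shift by simp
      show ?thesis
      proof (cases b c rule: prefix_comparison[case_names 1 2 3])
        case (1 u)
        show ?thesis
        proof (cases "\<exists>v. w = u @- v")
          case True
          then obtain v where "w = u @- v" ..
          moreover have "u \<in> lists {1..n}"
            using 1 l by simp
          moreover have "v \<in> streams {1..n}"
            using calculation w by (simp add: streams_iff_sset)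
          moreover have "d @ u \<in> lists {1..n}" "b \<in> lists {1..n}"
            using calculation(2) l by simp_all
          ultimately show ?thesis
            using 1 y xy z beta_Nf_shift[of "d @ u" n v a] beta_Nf_shift[of b n v a]
            by (simp add: map_comp_def del: beta.simps in_lists_conv_set)
        next
          case False
          then show ?thesis
            using 1 y xy z by (simp add: map_comp_def cylinder_def)
        qed
      next
        case (2 u)
        then show ?thesis
          using y xy l w z beta_Nf_shift[of d n w "a @ u"] beta_Nf_shift[of b n "u @- w" a]
          by (simp add: map_comp_def shift_streams del: beta.simps)
      next
        case 3
        have "c @- w \<noteq> b @- v" for v
        proof
          assume eq: "c @- w = b @- v"
          obtain e i b' j c' where "i \<noteq> j" "b = e @ i # b'" "c = e @ j # c'"
            using parallel_decomp[OF 3] by blast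
          with eq show False by simp
        qed
        then show ?thesis
          using 3 y xy by (simp add: map_comp_def cylinder_def beta_0)
      qed
    next
      case False
      then have "beta n y z = None" using xy by simp
      moreover have "z \<notin> cylinder n (d @ u)" for u
        using False by (auto simp: cylinder_def)
      ultimately show ?thesis
        using False xy
        by (cases b c rule: prefix_comparison) (simp_all add: map_comp_def beta_0)
    qed
  qed
qed

lemma Dom_0: "Dom n 0 = {}"
  by (simp add: Dom_def zero_polycyclic_def)

lemma Dom_Nf: "Dom n (Nf \<mu> \<nu>) = cylinder n \<nu>"
  by (auto simp: Dom_def split: if_splits)

definition idempotents :: "nat \<Rightarrow> polycyclic set" where
  "idempotents n = {e \<in> polycyc n. e * e = e}"

lemma idempotents_eq: "idempotents n = {0} \<union> {Nf \<mu> \<mu> | \<mu>. \<mu> \<in> lists {1..n}}"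
proof -
  have "e \<in> {0} \<union> {Nf \<mu> \<mu> | \<mu>. \<mu> \<in> lists {1..n}}" if "e \<in> polycyc n" "e * e = e" for e
  proof (cases "e = 0")
    case False
    with that(1) obtain \<mu> \<nu> where "e = Nf \<mu> \<nu>" "\<mu> \<in> lists {1..n}"
      by (auto simp: polycyc_def)
    with that(2) show ?thesis
      using Nf_idempotent[of \<mu> \<nu>] by simp
  qed simp
  moreover have "Nf \<mu> \<mu> \<in> idempotents n" if "\<mu> \<in> lists {1..n}" for \<mu>
    using that by (simp add: idempotents_def polycyc_def)
  moreover have "0 \<in> idempotents n"
    by (simp add: idempotents_def polycyc_def)
  ultimately show ?thesis
    unfolding idempotents_def by blast
qed

definition subsemigroup :: "nat \<Rightarrow> polycyclic set \<Rightarrow> bool" where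
  "subsemigroup n T \<longleftrightarrow> T \<subseteq> polycyc n \<and> (\<forall>x\<in>T. \<forall>y\<in>T. x * y \<in> T) \<and> (\<forall>x\<in>T. star x \<in> T)"

definition beta_join_closed :: "nat \<Rightarrow> polycyclic set \<Rightarrow> bool" where
  "beta_join_closed n T \<longleftrightarrow>
     subsemigroup n T \<and> idempotents n \<subseteq> T \<and>
     (\<forall>s\<in>polycyc n. s \<in> T \<longleftrightarrow>
        (\<exists>F. finite F \<and> F \<subseteq> idempotents n \<and> (\<forall>f\<in>F. s * f \<in> T) \<and>
             Dom n (star s * s) \<subseteq> (\<Union>f\<in>F. Dom n f)))"

definition polycyc_kl :: "nat \<Rightarrow> nat \<Rightarrow> nat \<Rightarrow> polycyclic set" where
  "polycyc_kl n k l =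
     {gen_word \<mu> * star (gen_word \<nu>) | \<mu> \<nu>.
        \<mu> \<in> lists {1..n} \<and> \<nu> \<in> lists {1..n} \<and> length \<mu> = k \<and> length \<nu> = l}"

definition polycyc_M :: "nat \<Rightarrow> polycyclic set" where
  "polycyc_M n = (\<Union>k. polycyc_kl n k k) \<union> {0}"

definition polycyc_mod :: "nat \<Rightarrow> nat \<Rightarrow> polycyclic set" where
  "polycyc_mod n m =
     \<Union>{polycyc_kl n k l | k l. int m dvd int k - int l} \<union> {0}"

end

theory Submission
  imports Defs "HOL-Computational_Algebra.Group_Closure"
begin

text \<open>
  Multiplying by elements of \<open>polycyc_M n\<close> changes \<open>\<mu>\<close> and \<open>\<nu>\<close> in \<open>s\<^sub>\<mu> s\<^sub>\<nu>\<^sup>*\<close> to arbitrary words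
  of the same lengths, and multiplying by \<open>s\<^sub>\<nu>\<^sub>\<gamma> s\<^sub>\<nu>\<^sub>\<gamma>\<^sup>*\<close> lengthens both words by \<open>|\<gamma>|\<close>.  Conversely
  \<open>C(\<nu>)\<close> is the union of the \<open>C(\<nu>i)\<close>, so join closedness allows shortening both words.
  Hence membership of \<open>s\<^sub>\<mu> s\<^sub>\<nu>\<^sup>*\<close> in \<open>T\<close> depends only on the degree \<open>|\<mu>| - |\<nu>|\<close>, and the degrees
  occurring in \<open>T\<close> form a subgroup of the integers.
\<close>

text \<open>Zero and closure under differences make \<open>G\<close> its own group closure, and a
  subgroup of the integers is generated by its gcd. For \<open>G = {0}\<close> the gcd is 0, which
  divides only 0.\<close>

lemma int_subgroup_eq_multiples_Gcd:
  fixes G :: "int set"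
  assumes "0 \<in> G" and "\<And>a b. a \<in> G \<Longrightarrow> b \<in> G \<Longrightarrow> a - b \<in> G"
  shows "d \<in> G \<longleftrightarrow> Gcd G dvd d"
proof -
  have "x \<in> G" if "x \<in> group_closure G" for x
    using that by induction (use assms in auto)
  then have "group_closure G = G"
    by (auto intro: group_closure.base)
  then have "G = range ((*) (Gcd G))"
    by (simp only: group_closure_eq)
  then have "d \<in> G \<longleftrightarrow> d \<in> range ((*) (Gcd G))"
    by (rule arg_cong)
  then show ?thesis
    by (simp only: image_iff dvd_def bex_UNIV)
qed

lemma mem_polycyc_kl_iff:
  "Nf \<mu> \<nu> \<in> polycyc_kl n k l \<longleftrightarrow>
     \<mu> \<in> lists {1..n} \<and> \<nu> \<in> lists {1..n} \<and> length \<mu> = k \<and> length \<nu> = l"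
  unfolding polycyc_kl_def gen_word_mult_star_gen_word by auto

lemma mem_polycyc_M_iff:
  "Nf \<mu> \<nu> \<in> polycyc_M n \<longleftrightarrow>
     \<mu> \<in> lists {1..n} \<and> \<nu> \<in> lists {1..n} \<and> length \<mu> = length \<nu>"
  by (auto simp: polycyc_M_def mem_polycyc_kl_iff simp del: in_lists_conv_set)

lemma mem_polycyc_mod_iff:
  "Nf \<mu> \<nu> \<in> polycyc_mod n m \<longleftrightarrow>
     \<mu> \<in> lists {1..n} \<and> \<nu> \<in> lists {1..n} \<and> int m dvd int (length \<mu>) - int (length \<nu>)"
proof -
  have "Nf \<mu> \<nu> \<in> polycyc_mod n m \<longleftrightarrow>
      (\<exists>k l. int m dvd int k - int l \<and> Nf \<mu> \<nu> \<in> polycyc_kl n k l)"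
    unfolding polycyc_mod_def by auto
  then show ?thesis
    by (auto simp: mem_polycyc_kl_iff simp del: in_lists_conv_set)
qed

lemma cylinder_subset_Union_cylinder:
  "cylinder n \<nu> \<subseteq> (\<Union>i\<in>{1..n}. cylinder n (\<nu> @ [i]))"
proof
  fix y
  assume "y \<in> cylinder n \<nu>"
  then obtain x where y: "y = \<nu> @- x" "y \<in> streams {1..n}"
    by (auto simp: cylinder_def)
  then have "shd x \<in> {1..n}"
    by (cases x) (auto simp: streams_iff_sset)
  moreover have "y = (\<nu> @ [shd x]) @- stl x"
    using y by simp
  ultimately show "y \<in> (\<Union>i\<in>{1..n}. cylinder n (\<nu> @ [i]))"
    using y(2) unfolding cylinder_def by blast
qed

context
  fixes n :: nat and T :: "polycyclic set"
  assumes closed: "beta_join_closed n T"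
    and M_subset: "polycyc_M n \<subseteq> T"
begin

lemma T_mult: "x \<in> T \<Longrightarrow> y \<in> T \<Longrightarrow> x * y \<in> T"
  and T_star: "x \<in> T \<Longrightarrow> star x \<in> T"
  and T_subset: "T \<subseteq> polycyc n"
  using closed by (auto simp: beta_join_closed_def subsemigroup_def)

text \<open>Since the lengths agree, \<open>Nf \<alpha> \<mu>\<close> and
  \<open>Nf \<nu> \<beta>\<close> lie in \<open>polycyc_M n\<close>; sandwiching
  \<open>Nf \<mu> \<nu>\<close> between them replaces both words.\<close>

lemma T_change_words:
  assumes "Nf \<mu> \<nu> \<in> T" "\<alpha> \<in> lists {1..n}" "\<beta> \<in> lists {1..n}"
    and "length \<alpha> = length \<mu>" "length \<beta> = length \<nu>"
  shows "Nf \<alpha> \<beta> \<in> T"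
proof -
  have "\<mu> \<in> lists {1..n}" "\<nu> \<in> lists {1..n}"
    using assms(1) T_subset by (auto simp: polycyc_def)
  then have "Nf \<alpha> \<mu> \<in> T" "Nf \<nu> \<beta> \<in> T"
    using assms M_subset mem_polycyc_M_iff by (metis subsetD)+
  then have "Nf \<alpha> \<mu> * Nf \<mu> \<nu> * Nf \<nu> \<beta> \<in> T"
    using assms(1) by (intro T_mult)
  then show ?thesis
    by simp
qed

lemma T_lengthen:
  assumes "Nf \<mu> \<nu> \<in> T" "\<gamma> \<in> lists {1..n}"
  shows "Nf (\<mu> @ \<gamma>) (\<nu> @ \<gamma>) \<in> T"
proof -
  have "\<nu> \<in> lists {1..n}"
    using assms(1) T_subset by (auto simp: polycyc_def)
  then have "Nf (\<nu> @ \<gamma>) (\<nu> @ \<gamma>) \<in> T"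
    using assms(2) M_subset mem_polycyc_M_iff[of "\<nu> @ \<gamma>" "\<nu> @ \<gamma>" n] by auto
  from T_mult[OF assms(1) this] show ?thesis
    by simp
qed

lemma T_shorten_letter:
  assumes words: "\<mu> \<in> lists {1..n}" "\<nu> \<in> lists {1..n}"
    and ext: "\<And>i. i \<in> {1..n} \<Longrightarrow> Nf (\<mu> @ [i]) (\<nu> @ [i]) \<in> T"
  shows "Nf \<mu> \<nu> \<in> T"
proof -
  \<comment> \<open>The domain of \<open>star s * s = Nf \<nu> \<nu>\<close> is the cylinder of
    \<open>\<nu>\<close>, which the one-letter extensions cover. Restricting
    \<open>s = Nf \<mu> \<nu>\<close> to one of them appends that letter to both words.\<close>
  define F where "F = (\<lambda>i. Nf (\<nu> @ [i]) (\<nu> @ [i])) ` {1..n}"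
  have "finite F"
    by (simp add: F_def)
  moreover have "F \<subseteq> idempotents n"
    using words by (auto simp: F_def idempotents_eq)
  moreover have "\<forall>f\<in>F. Nf \<mu> \<nu> * f \<in> T"
    using ext by (auto simp: F_def)
  moreover have "Dom n (star (Nf \<mu> \<nu>) * Nf \<mu> \<nu>) \<subseteq> (\<Union>f\<in>F. Dom n f)"
    using cylinder_subset_Union_cylinder[of n \<nu>] by (simp add: F_def Dom_Nf)
  moreover have "Nf \<mu> \<nu> \<in> polycyc n"
    using words by (simp add: polycyc_def)
  ultimately show ?thesis
    using closed unfolding beta_join_closed_def by blast
qed

lemma T_shorten:
  assumes "\<mu> \<in> lists {1..n}" "\<nu> \<in> lists {1..n}"
    and "\<And>\<gamma>. \<gamma> \<in> lists {1..n} \<Longrightarrow> length \<gamma> = j \<Longrightarrow> Nf (\<mu> @ \<gamma>) (\<nu> @ \<gamma>) \<in> T"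
  shows "Nf \<mu> \<nu> \<in> T"
  using assms
proof (induction j arbitrary: \<mu> \<nu>)
  case 0
  then show ?case
    using "0.prems"(3)[of "[]"] by simp
next
  case (Suc j)
  show ?case
  proof (rule T_shorten_letter)
    fix i assume i: "i \<in> {1..n}"
    show "Nf (\<mu> @ [i]) (\<nu> @ [i]) \<in> T"
    \<comment> \<open>The first letter of the suffix moves into both words, hence the induction over
      arbitrary \<open>\<mu>\<close> and \<open>\<nu>\<close>.\<close>
    proof (rule Suc.IH)
      fix \<gamma> assume "\<gamma> \<in> lists {1..n}" "length \<gamma> = j"
      then show "Nf ((\<mu> @ [i]) @ \<gamma>) ((\<nu> @ [i]) @ \<gamma>) \<in> T"
        using Suc.prems(3)[of "i # \<gamma>"] i by simp
    qed (use Suc.prems i in auto)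
  qed (use Suc.prems in auto)
qed

lemma T_degree:
  assumes \<mu>\<nu>: "Nf \<mu> \<nu> \<in> T" and words: "\<alpha> \<in> lists {1..n}" "\<beta> \<in> lists {1..n}"
    and deg: "int (length \<alpha>) - int (length \<beta>) = int (length \<mu>) - int (length \<nu>)"
  shows "Nf \<alpha> \<beta> \<in> T"
proof (rule T_shorten[OF words])
  fix \<gamma> assume \<gamma>: "\<gamma> \<in> lists {1..n}" "length \<gamma> = length \<mu>"
  \<comment> \<open>\<open>Nf \<mu> \<nu>\<close> lengthened by \<open>\<alpha>\<close> has the same word lengths as \<open>Nf \<alpha> \<beta>\<close> lengthened by \<open>\<gamma>\<close>.\<close>
  have "Nf (\<mu> @ \<alpha>) (\<nu> @ \<alpha>) \<in> T"
    using \<mu>\<nu> words by (intro T_lengthen)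
  then show "Nf (\<alpha> @ \<gamma>) (\<beta> @ \<gamma>) \<in> T"
    by (rule T_change_words) (use words \<gamma> deg in auto)
qed

definition degrees :: "int set" where
  "degrees = {int (length \<mu>) - int (length \<nu>) | \<mu> \<nu>. Nf \<mu> \<nu> \<in> T}"

lemma T_iff_degree:
  "Nf \<mu> \<nu> \<in> T \<longleftrightarrow> \<mu> \<in> lists {1..n} \<and> \<nu> \<in> lists {1..n} \<and>
     int (length \<mu>) - int (length \<nu>) \<in> degrees"
proof
  assume "Nf \<mu> \<nu> \<in> T"
  then show "\<mu> \<in> lists {1..n} \<and> \<nu> \<in> lists {1..n} \<and>
      int (length \<mu>) - int (length \<nu>) \<in> degrees"
    using T_subset by (auto simp: polycyc_def degrees_def)
next
  assume "\<mu> \<in> lists {1..n} \<and> \<nu> \<in> lists {1..n} \<and>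
      int (length \<mu>) - int (length \<nu>) \<in> degrees"
  then show "Nf \<mu> \<nu> \<in> T"
    unfolding degrees_def using T_degree by blast
qed

lemma degrees_subgroup:
  shows "0 \<in> degrees"
    and "a \<in> degrees \<Longrightarrow> b \<in> degrees \<Longrightarrow> a - b \<in> degrees"
proof -
  have "Nf [] [] \<in> T"
    using M_subset mem_polycyc_M_iff[of "[]" "[]" n] by auto
  then show "0 \<in> degrees"
    by (force simp: degrees_def)
next
  assume "a \<in> degrees" "b \<in> degrees"
  then obtain \<mu> \<nu> \<alpha> \<beta> where *: "Nf \<mu> \<nu> \<in> T" "Nf \<alpha> \<beta> \<in> T"
    and ab: "a = int (length \<mu>) - int (length \<nu>)" "b = int (length \<alpha>) - int (length \<beta>)"
    by (auto simp: degrees_def)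
  have words: "\<mu> \<in> lists {1..n}" "\<nu> \<in> lists {1..n}" "\<alpha> \<in> lists {1..n}" "\<beta> \<in> lists {1..n}"
    using * T_subset by (auto simp: polycyc_def)
  \<comment> \<open>Degrees add only in nonzero products. So representatives of degree
    \<open>a\<close> and \<open>-b\<close> are chosen that share the inner word
    \<open>\<nu> @ \<beta>\<close>; the second exists because
    \<open>star (Nf \<alpha> \<beta>)\<close> has degree \<open>-b\<close>.\<close>
  have "Nf (\<mu> @ \<beta>) (\<nu> @ \<beta>) \<in> T"
    using * words by (intro T_lengthen)
  moreover have "Nf (\<nu> @ \<beta>) (\<nu> @ \<alpha>) \<in> T"
    using T_degree[of \<beta> \<alpha> "\<nu> @ \<beta>" "\<nu> @ \<alpha>"] T_star[OF *(2)] words by simp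
  ultimately have "Nf (\<mu> @ \<beta>) (\<nu> @ \<beta>) * Nf (\<nu> @ \<beta>) (\<nu> @ \<alpha>) \<in> T"
    by (rule T_mult)
  then have "Nf (\<mu> @ \<beta>) (\<nu> @ \<alpha>) \<in> T"
    by simp
  moreover have "a - b = int (length (\<mu> @ \<beta>)) - int (length (\<nu> @ \<alpha>))"
    using ab by simp
  ultimately show "a - b \<in> degrees"
    unfolding degrees_def by blast
qed

lemma T_eq_polycyc_mod: "T = polycyc_mod n (nat (Gcd degrees))"
proof -
  have "x \<in> T \<longleftrightarrow> x \<in> polycyc_mod n (nat (Gcd degrees))" for x
  proof (cases x)
    case Zero
    then have "x \<in> T" "x \<in> polycyc_mod n (nat (Gcd degrees))"
      using M_subset by (auto simp: polycyc_M_def polycyc_mod_def zero_polycyclic_def)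
    then show ?thesis
      by simp
  next
    case (Nf \<mu> \<nu>)
    \<comment> \<open>Both memberships now differ only in the test on the degree. The gcd is
      nonnegative, so \<open>nat\<close> loses nothing.\<close>
    then show ?thesis
      using int_subgroup_eq_multiples_Gcd[OF degrees_subgroup]
      by (simp only: T_iff_degree mem_polycyc_mod_iff) simp
  qed
  then show ?thesis
    by blast
qed

end

theorem proposition4p2p2:
  fixes n :: nat and T :: "polycyclic set"
  assumes "n \<ge> 2"
    and "beta_join_closed n T"
    and "T \<subset> polycyc n"
    and "polycyc_M n \<subseteq> T"
  shows "\<exists>m::nat. T = polycyc_mod n m"
  using T_eq_polycyc_mod[OF assms(2,4)] by blast

end
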